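(* Let $K=\mathbb{R}$ or $\mathbb{C}$ and let $\mathcal{A}:\mathcal{I}^m\to M_n(K)$ be a hyperbolic or fast parabolic gasket. Then for every $M\in GL_n(K)$ $$\lim_{r\to\infty}\frac{\log N_{\mathcal{A}_M}(r)}{\log r}=s_{\mathcal{A}}.$$
   Context: $M_n(K)$ carries the max norm $\|M\|=\max_{i,j}|M^i_j|$, and $B^n_r\subset M_n(K)$ is the closed ball of radius $r$ (centred at $0$) in this norm. $\mathcal{I}^m$ is the free monoid of finite words in the letters $1,\dots,m$; $|I|$ is the length of $I$; the empty word is denoted $0$. $\mathcal{J}^m$ is the set of words $i_1i_2\dots i_k$, $k\ge2$, with $i_1\ne i_2=\dots=i_k$, and $\mathcal{J}^m\cdot\mathcal{I}^m=\{JL: J\in\mathcal{J}^m, L\in\mathcal{I}^m\}$. A homomorphism $\mathcal{A}:\mathcal{I}^m\to M_n(K)$ is written $A_I=\mathcal{A}(I)=A_{i_1}\cdots A_{i_k}$ for $I=i_1\dots i_k$ (with $A_0$ the identity matrix). For $M\in GL_n(K)$, $\mathcal{A}_M$ is the map $I\mapsto A_IM$, and $N_{\mathcal{A}_M}(r)$ is the cardinality of the set of matrices $B^n_r\cap\mathcal{A}_M(\mathcal{I}^m)$; $N_{\mathcal{A}}$ is the case $M=\mathbb{1}_n$. $\mathcal{A}$ is a gasket if $N_{\mathcal{A}}(r)<\infty$ for every $r>0$. Its exponent is $s_{\mathcal{A}}=\sup\{s\ge0:\sum_{I\in\mathcal{I}^m}\|A_I\|^{-s}=\infty\}$. Let $a_k=\min_{|I|=k}\|A_I\|$.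 The gasket is hyperbolic if there is $\alpha>1$ such that $a_k\asymp\alpha^k$ (the ratio of the two sides is bounded away from $0$ and $\infty$ for all $k$); it is parabolic if $a_k$ grows slower than exponentially. It is fast if there is $c>0$ with $\|A_{IJ}\|\ge c\|A_I\|\|A_J\|$ for all $I\in\mathcal{I}^m$ and $J\in\mathcal{J}^m\cdot\mathcal{I}^m$; "fast parabolic" means both fast and parabolic.
   Formalization: As stated this fails (n=1, m=2, A_1=A_2=2: s=1 but the limit is 0). It is proved for the set count N when A is injective on words, and for every such A when N and "gasket" count words with multiplicity instead of distinct matrices. *)

theory Defs
  imports "HOL-Analysis.Analysis" "HOL-Library.Landau_Symbols"
begin

definition words :: "nat \<Rightarrow> nat list set" where
  "words m = lists {1..m}"

definition turn_words :: "nat \<Rightarrow> nat list set" where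
  "turn_words m = {i # replicate k j | i j k. i \<in> {1..m} \<and> j \<in> {1..m} \<and> i \<noteq> j \<and> k \<ge> 1}"

definition max_norm :: "'k::real_normed_field^'n^'n \<Rightarrow> real" where
  "max_norm X = Max (range (\<lambda>(i, j). norm (X $ i $ j)))"

definition max_ball :: "real \<Rightarrow> ('k::real_normed_field^'n^'n) set" where
  "max_ball r = {X. max_norm X \<le> r}"

definition word_hom :: "nat \<Rightarrow> (nat list \<Rightarrow> 'k::real_normed_field^'n^'n) \<Rightarrow> bool" where
  "word_hom m A \<longleftrightarrow> A [] = mat 1 \<and> (\<forall>I\<in>words m. \<forall>J\<in>words m. A (I @ J) = A I ** A J)"

text \<open>
  Two ways of counting the part of a family \<open>F\<close> of matrices, indexed by words, that lies in
  a ball: as a set of matrices, or with multiplicity, i.e. counting each matrix once for every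
  word that represents it.  They agree when \<open>F\<close> is injective on words (a free semigroup),
  but not in general: for \<open>n = 1\<close>, \<open>m = 2\<close> and \<open>A [1] = A [2] = 2\<close> there are \<open>2 ^ k\<close> words, but only
  one matrix, of norm \<open>2 ^ k\<close>.  As the exponent sums over words, distinct matrices are
  the right count only in the injective case.
\<close>

definition num_matrices :: "nat \<Rightarrow> (nat list \<Rightarrow> 'k::real_normed_field^'n^'n) \<Rightarrow> real \<Rightarrow> nat" where
  "num_matrices m F r = card (max_ball r \<inter> F ` words m)"

definition num_words :: "nat \<Rightarrow> (nat list \<Rightarrow> 'k::real_normed_field^'n^'n) \<Rightarrow> real \<Rightarrow> nat" where
  "num_words m F r = card {I \<in> words m. F I \<in> max_ball r}"

text \<open>Finiteness is stated directly, since \<open>card\<close> of an infinite set is \<open>0\<close>.\<close>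

definition gasket :: "nat \<Rightarrow> (nat list \<Rightarrow> 'k::real_normed_field^'n^'n) \<Rightarrow> bool" where
  "gasket m A \<longleftrightarrow> (\<forall>r>0. finite (max_ball r \<inter> A ` words m))"

definition gasket_mult :: "nat \<Rightarrow> (nat list \<Rightarrow> 'k::real_normed_field^'n^'n) \<Rightarrow> bool" where
  "gasket_mult m A \<longleftrightarrow> (\<forall>r>0. finite {I \<in> words m. A I \<in> max_ball r})"

lemma image_ball_eq: "max_ball r \<inter> F ` words m = F ` {I \<in> words m. F I \<in> max_ball r}"
  by auto

lemma num_words_eq_num_matrices:
  assumes "inj_on F (words m)"
  shows "num_words m F r = num_matrices m F r"
  unfolding num_matrices_def num_words_def image_ball_eq
  by (rule card_image[symmetric]) (rule inj_on_subset[OF assms], auto)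

lemma gasket_mult_iff_gasket:
  assumes "inj_on A (words m)"
  shows "gasket_mult m A \<longleftrightarrow> gasket m A"
proof -
  have "inj_on A {I \<in> words m. A I \<in> max_ball r}" for r
    by (rule inj_on_subset[OF assms]) auto
  then show ?thesis
    unfolding gasket_def gasket_mult_def image_ball_eq by (simp add: finite_image_iff)
qed

text \<open>
  The series has nonnegative terms, so it diverges to infinity iff it is not summable.  The
  value is taken in the extended reals so that an unbounded set of \<open>s\<close> gives \<open>\<infinity>\<close>.
  (The convention \<open>0 powr x = 0\<close> plays no role: \<open>A I = 0\<close> would give
  \<open>A (I @ J) = 0\<close> for all \<open>J\<close>, which is impossible for an injective \<open>A\<close> and for a gasket
  counted with multiplicity, if \<open>m \<ge> 1\<close>.)
\<close>

definition exponent :: "nat \<Rightarrow> (nat list \<Rightarrow> 'k::real_normed_field^'n^'n) \<Rightarrow> ereal" where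
  "exponent m A = Sup (ereal `
     {s. s \<ge> 0 \<and> \<not> (\<lambda>I. max_norm (A I) powr (- s)) summable_on words m})"

definition min_norm :: "nat \<Rightarrow> (nat list \<Rightarrow> 'k::real_normed_field^'n^'n) \<Rightarrow> nat \<Rightarrow> real" where
  "min_norm m A k = Min ((\<lambda>I. max_norm (A I)) ` {I \<in> words m. length I = k})"

text \<open>The next three predicates do not include the requirement that \<open>A\<close> is a gasket.\<close>

definition hyperbolic :: "nat \<Rightarrow> (nat list \<Rightarrow> 'k::real_normed_field^'n^'n) \<Rightarrow> bool" where
  "hyperbolic m A \<longleftrightarrow> (\<exists>\<alpha>>1. \<exists>c>0. \<exists>C>0. \<forall>k.
     c * \<alpha> ^ k \<le> min_norm m A k \<and> min_norm m A k \<le> C * \<alpha> ^ k)"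

definition parabolic :: "nat \<Rightarrow> (nat list \<Rightarrow> 'k::real_normed_field^'n^'n) \<Rightarrow> bool" where
  "parabolic m A \<longleftrightarrow> (\<forall>\<alpha>>1. min_norm m A \<in> o(\<lambda>k. \<alpha> ^ k))"

definition fast :: "nat \<Rightarrow> (nat list \<Rightarrow> 'k::real_normed_field^'n^'n) \<Rightarrow> bool" where
  "fast m A \<longleftrightarrow> (\<exists>c>0. \<forall>I\<in>words m. \<forall>J\<in>turn_words m. \<forall>L\<in>words m.
     max_norm (A (I @ J @ L)) \<ge> c * max_norm (A I) * max_norm (A (J @ L)))"

end

theory Submission
  imports Defs "Jordan_Normal_Form.Jordan_Normal_Form_Existence" "HOL-Real_Asymp.Real_Asymp"
begin

text \<open>
  Write \<open>N r\<close> for the number of words \<open>I\<close> with \<open>\<parallel>A I\<parallel> \<le> r\<close>. In general the exponent is the limes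
  superior of \<open>ln (N r) / ln r\<close>, so it suffices that a lower bound \<open>r powr t \<le> N r\<close> for arbitrarily
  large \<open>r\<close> implies \<open>r powr t' \<le> N r\<close> for all large \<open>r\<close>, whenever \<open>t' < t\<close>.

  Suppose the words of norm at most \<open>r\<close> fall into \<open>O (ln r)\<close> classes, each of which is a prefix code
  up to a bounded change of norm. A largest class \<open>S\<close> has at least \<open>N r / O (ln r)\<close> elements, and the
  \<open>j\<close>-fold concatenations of its elements are pairwise distinct, so submultiplicativity gives
  \<open>N ((K * r) ^ j) \<ge> card S ^ j\<close>; one good \<open>r\<close> thus controls all scales.
  In the hyperbolic case the classes are given by the length, in the fast case with at least two
  letters by the number of maximal blocks of equal letters: every turn costs a constant factor, up to
  grouping boundedly many turns. For a single letter fastness is void; there Jordan normal form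
  shows that the norms of the powers \<open>X ^ k\<close>, if unbounded and subexponential, grow like \<open>k ^ d\<close>.
\<close>

no_notation Matrix.vec_index (infixl "$" 100)
hide_const (open) Matrix.mat

section \<open>Counting functions and the exponent\<close>

definition count_le :: "'a set \<Rightarrow> ('a \<Rightarrow> real) \<Rightarrow> real \<Rightarrow> nat" where
  "count_le W u r = card {x \<in> W. u x \<le> r}"

text \<open>The upper and the lower growth order of \<open>N\<close> agree. Stated by comparison
  with powers of \<open>r\<close>, this needs no logarithm of 0 and no separate treatment of an
  infinite order.\<close>

definition regular_growth :: "(real \<Rightarrow> nat) \<Rightarrow> bool" where
  "regular_growth N \<longleftrightarrow> (\<forall>t t'. t' < t \<longrightarrow> (\<exists>\<^sub>F r in at_top. r powr t \<le> real (N r)) \<longrightarrow>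
     (\<forall>\<^sub>F r in at_top. r powr t' \<le> real (N r)))"

lemma count_le_mono:
  assumes "finite {x \<in> W. u x \<le> r'}" "\<And>x. x \<in> W \<Longrightarrow> v x \<le> r \<Longrightarrow> u x \<le> r'"
  shows "count_le W v r \<le> count_le W u r'"
  unfolding count_le_def using assms by (intro card_mono) auto

text \<open>Markov's inequality: each index counted up to \<open>r\<close> contributes at least
  \<open>r powr (- s)\<close> to the convergent series.\<close>

lemma count_le_powr_if_summable:
  assumes fin: "\<And>r. finite {x \<in> W. u x \<le> r}" and pos: "\<And>x. x \<in> W \<Longrightarrow> u x > 0"
    and summable: "(\<lambda>x. u x powr (- s)) summable_on W" and s: "s \<ge> 0"
  shows "\<exists>C. \<forall>r>0. real (count_le W u r) \<le> C * r powr s"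
proof (intro exI allI impI)
  fix r :: real
  assume r: "r > 0"
  let ?L = "{x \<in> W. u x \<le> r}"
  have "real (count_le W u r) * r powr (- s) = (\<Sum>x\<in>?L. r powr (- s))"
    by (simp add: count_le_def)
  also have "\<dots> \<le> (\<Sum>x\<in>?L. u x powr (- s))"
    using pos s by (intro sum_mono powr_mono2') auto
  also have "\<dots> \<le> infsum (\<lambda>x. u x powr (- s)) W"
    using fin by (intro finite_sum_le_infsum[OF summable]) auto
  finally show "real (count_le W u r) \<le> infsum (\<lambda>x. u x powr (- s)) W * r powr s"
    using r by (simp add: powr_minus field_simps)
qed

text \<open>Split the indices into dyadic shells by the size of \<open>u\<close>. The counting bound
  makes shell \<open>k\<close> contribute at most \<open>2 powr t * q ^ k\<close> with
  \<open>q = 2 powr (t - s) < 1\<close>, so the series is dominated by a geometric one.\<close>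

lemma summable_if_count_le_powr:
  assumes fin: "\<And>r. finite {x \<in> W. u x \<le> r}" and t: "0 \<le> t" "t < s"
    and ev: "\<forall>\<^sub>F r in at_top. real (count_le W u r) \<le> r powr t"
  shows "(\<lambda>x. u x powr (- s)) summable_on W"
proof -
  obtain r0 where r0: "\<And>r. r \<ge> r0 \<Longrightarrow> real (count_le W u r) \<le> r powr t"
    using ev by (auto simp: eventually_at_top_linorder)
  \<comment> \<open>Outside this finite set \<open>log 2 (u x)\<close> is positive, so that
    \<open>nat\<close> does not distort the shell index, and \<open>u x\<close> exceeds the
    threshold of the counting bound.\<close>
  define W0 where "W0 = {x \<in> W. u x \<le> max 1 r0}"
  define q where "q = 2 powr (t - s)"
  have q: "0 < q" "q < 1" using t by (auto simp: q_def intro: powr_less_one)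
  have "(\<lambda>x. u x powr (- s)) summable_on (W - W0)"
  proof (rule nonneg_bdd_above_summable_on)
    show "bdd_above (sum (\<lambda>x. u x powr (- s)) ` {F. F \<subseteq> W - W0 \<and> finite F})"
    proof (intro bdd_aboveI2[where M = "2 powr t * (1 / (1 - q))"])
      fix F assume "F \<in> {F. F \<subseteq> W - W0 \<and> finite F}"
      then have F: "F \<subseteq> W" "finite F" and big: "\<And>x. x \<in> F \<Longrightarrow> u x > 1 \<and> u x > r0"
        by (auto simp: W0_def)
      define j where "j x = nat \<lfloor>log 2 (u x)\<rfloor>" for x
      have shell: "2 powr real (j x) \<le> u x" "u x \<le> 2 powr (real (j x) + 1)" if "x \<in> F" for x
      proof -
        have "u x > 1" using big that by auto
        then have "log 2 (u x) > 0" by simp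
        then have "real (j x) \<le> log 2 (u x)" "log 2 (u x) \<le> real (j x) + 1"
          unfolding j_def by linarith+
        with \<open>u x > 1\<close> show "2 powr real (j x) \<le> u x" "u x \<le> 2 powr (real (j x) + 1)"
          by (auto simp: le_log_iff log_le_iff)
      qed
      have "(\<Sum>x\<in>F. u x powr (- s)) = (\<Sum>k\<in>j ` F. \<Sum>x | x \<in> F \<and> j x = k. u x powr (- s))"
        by (rule sum.image_gen[OF F(2)])
      also have "\<dots> \<le> (\<Sum>k\<in>j ` F. 2 powr t * q ^ k)"
      proof (rule sum_mono)
        fix k assume "k \<in> j ` F"
        then obtain y where y: "y \<in> F" "j y = k" by auto
        have "(\<Sum>x | x \<in> F \<and> j x = k. u x powr (- s)) \<le> (\<Sum>x | x \<in> F \<and> j x = k. (2 powr real k) powr (- s))"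
          using shell t by (intro sum_mono powr_mono2') auto
        also have "\<dots> = real (card {x \<in> F. j x = k}) * (2 powr real k) powr (- s)" by simp
        also have "\<dots> \<le> (2 powr (real k + 1)) powr t * (2 powr real k) powr (- s)"
        proof (rule mult_right_mono)
          have "card {x \<in> F. j x = k} \<le> count_le W u (2 powr (real k + 1))"
            unfolding count_le_def using shell F by (intro card_mono fin) auto
          \<comment> \<open>Only nonempty shells occur: the element \<open>y\<close> of shell
            \<open>k\<close> exceeds \<open>r0\<close> and lies below this radius.\<close>
          moreover have "2 powr (real k + 1) \<ge> r0"
            using shell(2)[OF y(1)] big[OF y(1)] y(2) by auto
          ultimately show "real (card {x \<in> F. j x = k}) \<le> (2 powr (real k + 1)) powr t"
            using r0[of "2 powr (real k + 1)"] by linarith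
        qed simp
        also have "\<dots> = 2 powr t * q ^ k"
          by (simp add: q_def powr_powr powr_realpow[symmetric] powr_add[symmetric] algebra_simps)
        finally show "(\<Sum>x | x \<in> F \<and> j x = k. u x powr (- s)) \<le> 2 powr t * q ^ k" .
      qed
      also have "\<dots> = 2 powr t * (\<Sum>k\<in>j ` F. q ^ k)" by (simp add: sum_distrib_left)
      also have "\<dots> \<le> 2 powr t * (\<Sum>k. q ^ k)"
        using q F by (intro mult_left_mono sum_le_suminf summable_geometric) auto
      also have "(\<Sum>k. q ^ k) = 1 / (1 - q)" using q by (intro suminf_geometric) auto
      finally show "(\<Sum>x\<in>F. u x powr (- s)) \<le> 2 powr t * (1 / (1 - q))" .
    qed
  qed auto
  moreover have "(\<lambda>x. u x powr (- s)) summable_on W0"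
    using fin by (intro summable_on_finite) (auto simp: W0_def)
  ultimately have "(\<lambda>x. u x powr (- s)) summable_on ((W - W0) \<union> W0)"
    by (intro summable_on_Un_disjoint) auto
  moreover have "(W - W0) \<union> W0 = W" by (auto simp: W0_def)
  ultimately show ?thesis by simp
qed

text \<open>Above the exponent the series converges, and Markov's inequality bounds the count from
  above. Below it the series diverges, so the count is large for arbitrarily large \<open>r\<close>,
  hence by regular growth for all large \<open>r\<close>. The weight \<open>v\<close> stands for the
  norms after multiplication by \<open>M\<close>; constant factors vanish in the quotient of
  logarithms.\<close>

lemma tendsto_ln_count_le:
  assumes inf: "infinite W" and fin: "\<And>r. finite {x \<in> W. u x \<le> r}"
    and pos: "\<And>x. x \<in> W \<Longrightarrow> u x > 0"
    and c: "c1 > 0" "c2 > 0" "\<And>x. x \<in> W \<Longrightarrow> c1 * u x \<le> v x" "\<And>x. x \<in> W \<Longrightarrow> v x \<le> c2 * u x"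
    and reg: "regular_growth (count_le W u)"
  shows "((\<lambda>r. ereal (ln (real (count_le W v r)) / ln r)) \<longlongrightarrow>
    Sup (ereal ` {s. s \<ge> 0 \<and> \<not> (\<lambda>x. u x powr (- s)) summable_on W})) at_top"
    (is "(_ \<longlongrightarrow> Sup (ereal ` ?D)) _")
proof -
  have finv: "finite {x \<in> W. v x \<le> r}" for r
    by (rule finite_subset[OF _ fin[of "r / c1"]]) (use c in \<open>auto simp: field_simps intro: order_trans\<close>)
  have ge: "count_le W u (r / c2) \<le> count_le W v r" for r
    using c by (intro count_le_mono finv) (force simp: field_simps)
  have le: "count_le W v r \<le> count_le W u (r / c1)" for r
    using c by (intro count_le_mono fin) (force simp: field_simps)
  obtain x0 where x0: "x0 \<in> W" using inf by (cases "W = {}") auto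
  have N1: "\<forall>\<^sub>F r in at_top. count_le W v r \<ge> 1"
    using eventually_ge_at_top[of "v x0"]
  proof eventually_elim
    case (elim r)
    then have "card {x0} \<le> count_le W v r"
      unfolding count_le_def using x0 finv by (intro card_mono) auto
    then show ?case by simp
  qed
  \<comment> \<open>All terms are 1 at \<open>s = 0\<close>, by positivity of \<open>u\<close>.
    Hence the supremum is not over the empty set, where it would be minus infinity.\<close>
  have "0 \<in> ?D"
  proof -
    have "(\<lambda>x. u x powr (- 0)) summable_on W \<longleftrightarrow> (\<lambda>_. 1 :: real) summable_on W"
      using pos by (intro summable_on_cong) force
    also have "\<not> \<dots>"
    proof
      assume "(\<lambda>_. 1 :: real) summable_on W"
      then have B: "real (card F) \<le> infsum (\<lambda>_. 1) W" if "finite F" "F \<subseteq> W" for F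
        using finite_sum_le_infsum[of "\<lambda>_. 1 :: real" W F] that by simp
      obtain F where "finite F" "F \<subseteq> W" "card F = nat \<lceil>infsum (\<lambda>_. 1 :: real) W\<rceil> + 1"
        using infinite_arbitrarily_large[OF inf] by blast
      with B[of F] show False by linarith
    qed
    finally show ?thesis by simp
  qed
  then have Sup0: "0 \<le> Sup (ereal ` ?D)"
    by (intro Sup_upper2[of "ereal 0"]) auto
  show ?thesis
  proof (rule order_tendstoI)
    fix a assume "a < Sup (ereal ` ?D)"
    then obtain s where s: "s \<ge> 0" "\<not> (\<lambda>x. u x powr (- s)) summable_on W" "a < ereal s"
      by (auto simp: less_Sup_iff)
    show "\<forall>\<^sub>F r in at_top. a < ereal (ln (real (count_le W v r)) / ln r)"
    \<comment> \<open>For \<open>s = 0\<close> there is no room for a nonnegative \<open>t\<close>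
      below \<open>s\<close>, but \<open>N \<ge> 1\<close> already makes the quotient
      nonnegative.\<close>
    proof (cases "s = 0")
      case True
      show ?thesis
        using N1 eventually_gt_at_top[of 1]
      proof eventually_elim
        case (elim r)
        then have "0 \<le> ln (real (count_le W v r)) / ln r" by simp
        with s(3) True show ?case by (meson ereal_less_eq(3) order_less_le_trans)
      qed
    next
      case False
      with s have "max a 0 < ereal s" by auto
      then obtain z where z: "max a 0 < ereal z" "ereal z < ereal s"
        using ereal_dense2 by blast
      then have az: "a < ereal z" "0 < z" "z < s" by auto
      \<comment> \<open>In the chain \<open>z < t' < t < s\<close> the three gaps absorb the
        constant \<open>c2\<close>, the loss in regular growth, and the passage from divergence to a
        count.\<close>
      define t where "t = (z + s) / 2"
      define t' where "t' = (z + t) / 2"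
      have t: "z < t'" "t' < t" "t < s" using az by (auto simp: t_def t'_def)
      have "\<not> (\<forall>\<^sub>F r in at_top. real (count_le W u r) \<le> r powr t)"
        using summable_if_count_le_powr[of W u t s] fin s(2) t az by auto
      then have "\<exists>\<^sub>F r in at_top. r powr t \<le> real (count_le W u r)"
        unfolding not_eventually by (rule frequently_elim1) auto
      then have "\<forall>\<^sub>F r in at_top. r powr t' \<le> real (count_le W u r)"
        using reg t(2) unfolding regular_growth_def by blast
      then have ev: "\<forall>\<^sub>F r in at_top. (r / c2) powr t' \<le> real (count_le W u (r / c2))"
        by (rule eventually_compose_filterlim) (use c(2) in real_asymp)
      have "\<forall>\<^sub>F r in at_top. r powr z < (r / c2) powr t'"
        using c(2) t(1) by real_asymp
      then show ?thesis
        using ev eventually_gt_at_top[of 1]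
      proof eventually_elim
        case (elim r)
        then have *: "r powr z < real (count_le W v r)"
          using ge[of r] by linarith
        have "z * ln r = ln (r powr z)" using elim by (simp add: ln_powr)
        also have "\<dots> < ln (real (count_le W v r))"
        proof (subst ln_less_cancel_iff)
          show "0 < r powr z" using elim by simp
          with * show "0 < real (count_le W v r)" by linarith
        qed (use * in auto)
        finally have "z < ln (real (count_le W v r)) / ln r"
          using elim by (simp add: field_simps)
        with az(1) show ?case by (meson less_ereal.simps(1) order_less_trans)
      qed
    qed
  next
    fix a assume "Sup (ereal ` ?D) < a"
    then obtain z where z: "Sup (ereal ` ?D) < ereal z" "ereal z < a"
      using ereal_dense2 by blast
    then obtain s where s: "Sup (ereal ` ?D) < ereal s" "ereal s < ereal z"
      using ereal_dense2 by blast
    have "ereal 0 < ereal s" using order.strict_trans1[OF Sup0 s(1)] by (simp add: zero_ereal_def)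
    then have "s > 0" by simp
    moreover have "s \<notin> ?D"
    proof
      assume "s \<in> ?D"
      then have "ereal s \<le> Sup (ereal ` ?D)" by (intro Sup_upper imageI)
      with s(1) show False by (simp add: leD)
    qed
    ultimately have "(\<lambda>x. u x powr (- s)) summable_on W" by auto
    then obtain C where C: "\<And>r. r > 0 \<Longrightarrow> real (count_le W u r) \<le> C * r powr s"
      using count_le_powr_if_summable[of W u s] fin pos \<open>s > 0\<close> by auto
    have sz: "s < z" using s by simp
    \<comment> \<open>\<open>C\<close> is not known to be positive; a larger positive constant is
      still absorbed by the gap between \<open>s\<close> and \<open>z\<close>.\<close>
    have "\<forall>\<^sub>F r in at_top. (max 1 C) * (r / c1) powr s \<le> r powr z"
    proof -
      have "max 1 C > 0" by simp
      then show ?thesis using sz c(1) by real_asymp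
    qed
    then show "\<forall>\<^sub>F r in at_top. ereal (ln (real (count_le W v r)) / ln r) < a"
      using N1 eventually_gt_at_top[of 1]
    proof eventually_elim
      case (elim r)
      have "real (count_le W v r) \<le> C * (r / c1) powr s"
        using le[of r] C[of "r / c1"] elim c(1) by fastforce
      also have "\<dots> \<le> max 1 C * (r / c1) powr s" by (intro mult_right_mono) auto
      finally have "real (count_le W v r) \<le> r powr z" using elim by linarith
      then have "ln (real (count_le W v r)) \<le> ln (r powr z)"
        using elim by (subst ln_le_cancel_iff) auto
      then have "ln (real (count_le W v r)) / ln r \<le> z"
        using elim by (simp add: ln_powr field_simps)
      with z(2) show ?case by (meson ereal_less_eq(3) order_le_less_trans)
    qed
  qed
qed

section \<open>Prefix codes\<close>

text \<open>Unique decoding: the concatenation determines its first factor, which is then cancelled.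
  The number of factors is fixed because the code consisting of the empty word alone is
  allowed.\<close>

lemma inj_on_concat_prefix_code:
  assumes "\<And>x y s t. x \<in> S \<Longrightarrow> y \<in> S \<Longrightarrow> x @ s = y @ t \<Longrightarrow> x = y"
  shows "inj_on concat {xs. set xs \<subseteq> S \<and> length xs = j}"
proof -
  have "xs = ys" if "concat xs = concat ys" "length xs = length ys" "set xs \<subseteq> S" "set ys \<subseteq> S" for xs ys
    using that(2,1,3,4)
  proof (induction rule: list_induct2)
    case (Cons x xs y ys)
    then have "x = y" using assms[of x y "concat xs" "concat ys"] by simp
    with Cons show ?case by simp
  qed simp
  then show ?thesis by (auto intro!: inj_onI)
qed

text \<open>Concatenating \<open>j\<close> code words gives \<open>card S ^ j\<close> distinct
  words; every factor costs at most \<open>K * u x \<le> \<rho>\<close>.\<close>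

lemma card_power_le_count_le:
  fixes u :: "'b list \<Rightarrow> real"
  assumes fin: "\<And>r. finite {I \<in> lists X. u I \<le> r}" and pos: "\<And>I. I \<in> lists X \<Longrightarrow> u I > 0"
    and empty: "u [] \<le> 1"
    and mult: "\<And>I J. I \<in> lists X \<Longrightarrow> J \<in> lists X \<Longrightarrow> u (I @ J) \<le> K * u I * u J"
    and code: "\<And>x y s t. x \<in> S \<Longrightarrow> y \<in> S \<Longrightarrow> x @ s = y @ t \<Longrightarrow> x = y"
    and S: "finite S" "S \<subseteq> lists X" "\<And>x. x \<in> S \<Longrightarrow> K * u x \<le> \<rho>" and K: "K > 0" and \<rho>: "\<rho> \<ge> 0"
  shows "card S ^ j \<le> count_le (lists X) u (\<rho> ^ j)"
proof -
  have "concat xs \<in> lists X \<and> u (concat xs) \<le> \<rho> ^ length xs" if "set xs \<subseteq> S" for xs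
    using that
  proof (induction xs)
    case Nil
    then show ?case using empty by simp
  next
    case (Cons x xs)
    then have x: "x \<in> lists X" "concat xs \<in> lists X" "K * u x \<le> \<rho>" "u (concat xs) \<le> \<rho> ^ length xs"
      using S by auto
    have "u (x @ concat xs) \<le> (K * u x) * u (concat xs)" using mult[OF x(1,2)] .
    also have "\<dots> \<le> \<rho> * \<rho> ^ length xs"
      using x(3,4) \<rho> pos[OF x(2)] by (intro mult_mono) auto
    finally show ?case using x(1,2) by simp
  qed
  then have "concat ` {xs. set xs \<subseteq> S \<and> length xs = j} \<subseteq> {I \<in> lists X. u I \<le> \<rho> ^ j}"
    by blast
  from card_mono[OF fin this] show ?thesis
    using card_image[OF inj_on_concat_prefix_code[OF code]]
    by (simp add: count_le_def card_lists_length_eq[OF S(1)])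
qed

text \<open>The label \<open>h\<close> sorts words into classes, and \<open>e\<close> alters a word
  at bounded cost so that each class becomes a prefix code. Exponential growth in \<open>h\<close>
  leaves only logarithmically many classes up to norm \<open>r\<close>, so one class carries almost
  the whole count, and its concatenations reach all larger scales.\<close>

lemma regular_growth_prefix_code:
  fixes u :: "'b list \<Rightarrow> real" and h :: "'b list \<Rightarrow> nat"
  assumes fin: "\<And>r. finite {I \<in> lists X. u I \<le> r}" and pos: "\<And>I. I \<in> lists X \<Longrightarrow> u I > 0"
    and empty: "u [] \<le> 1"
    and mult: "\<And>I J. I \<in> lists X \<Longrightarrow> J \<in> lists X \<Longrightarrow> u (I @ J) \<le> K * u I * u J" and K: "K > 0"
    and e: "\<And>I. I \<in> lists X \<Longrightarrow> e I \<in> lists X" "inj_on e (lists X)"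
    and C: "C > 0" "\<And>I. I \<in> lists X \<Longrightarrow> u (e I) \<le> C * u I"
    and code: "\<And>I J s t. I \<in> lists X \<Longrightarrow> J \<in> lists X \<Longrightarrow> h I = h J \<Longrightarrow> e I @ s = e J @ t \<Longrightarrow> e I = e J"
    and \<delta>: "\<delta> > 0" "\<kappa> > 1" "\<And>I. I \<in> lists X \<Longrightarrow> \<delta> * \<kappa> ^ h I \<le> u I"
  shows "regular_growth (count_le (lists X) u)"
  unfolding regular_growth_def
proof (intro allI impI)
  fix t t' :: real
  let ?N = "count_le (lists X) u"
  assume t: "t' < t" and freq: "\<exists>\<^sub>F r in at_top. r powr t \<le> real (?N r)"
  \<comment> \<open>For \<open>t' \<le> 0\<close> counting the empty word is enough.\<close>
  show "\<forall>\<^sub>F r in at_top. r powr t' \<le> real (?N r)"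
  proof (cases "t' \<le> 0")
    case True
    show ?thesis
      using eventually_ge_at_top[of 1]
    proof eventually_elim
      case (elim r)
      have "card {[] :: 'b list} \<le> ?N r"
        unfolding count_le_def using empty elim by (intro card_mono fin) auto
      moreover have "r powr t' \<le> r powr 0" using True elim by (intro powr_mono) auto
      ultimately show ?case using elim by simp
    qed
  next
    case False
    define s where "s = (t' + t) / 2"
    have s: "0 < t'" "t' < s" "s < t" using t False by (auto simp: s_def)
    have "ln \<kappa> > 0" using \<delta>(2) by simp
    \<comment> \<open>The gap \<open>s < t\<close> pays both for enlarging \<open>r\<close> to
      \<open>K * C * r\<close> and for the number of classes. A single such \<open>r\<close> is used
      below.\<close>
    then have "\<forall>\<^sub>F r in at_top. (K * C * r) powr s * (2 + ln (r / \<delta>) / ln \<kappa>) < r powr t"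
      using s(3) \<delta>(1) K C(1) by real_asymp
    then have "\<forall>\<^sub>F r in at_top. (K * C * r) powr s * (2 + ln (r / \<delta>) / ln \<kappa>) < r powr t \<and>
        r > 1 / (K * C) \<and> r > \<delta> \<and> r > 0"
      by (intro eventually_conj eventually_gt_at_top)
    from frequently_ex[OF frequently_rev_mp[OF freq eventually_mono[OF this]]]
    obtain r where r: "r powr t \<le> real (?N r)" "r > 1 / (K * C)" "r > \<delta>" "r > 0"
      and r_big: "(K * C * r) powr s * (2 + ln (r / \<delta>) / ln \<kappa>) < r powr t"
      by blast
    define \<rho> where "\<rho> = K * C * r"
    have \<rho>: "\<rho> > 1" using r(2) K C(1) by (simp add: \<rho>_def field_simps)
    define L where "L = {I \<in> lists X. u I \<le> r}"
    have finL: "finite L" unfolding L_def by (rule fin)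
    define Q where "Q = nat \<lfloor>ln (r / \<delta>) / ln \<kappa>\<rfloor>"
    have Q: "real Q + 1 \<le> 2 + ln (r / \<delta>) / ln \<kappa>"
    proof -
      have "ln (r / \<delta>) / ln \<kappa> \<ge> 0" using \<open>ln \<kappa> > 0\<close> r(3) \<delta>(1) by simp
      then show ?thesis unfolding Q_def by linarith
    qed
    have h_le: "h I \<le> Q" if "I \<in> L" for I
    proof -
      have "\<kappa> ^ h I \<le> r / \<delta>"
        using \<delta>(3)[of I] \<delta>(1) that by (auto simp: L_def field_simps)
      then have "ln (\<kappa> ^ h I) \<le> ln (r / \<delta>)"
        using \<delta> r by (subst ln_le_cancel_iff) auto
      then have "real (h I) \<le> ln (r / \<delta>) / ln \<kappa>"
        using \<open>ln \<kappa> > 0\<close> \<delta>(2) by (simp add: ln_realpow field_simps)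
      then show ?thesis unfolding Q_def by linarith
    qed
    \<comment> \<open>Pigeonhole: if each of the \<open>Q + 1\<close> classes had at most
      \<open>\<rho> powr s\<close> words, \<open>L\<close> would have fewer than
      \<open>r powr t\<close>.\<close>
    obtain q where q: "\<rho> powr s \<le> real (card {I \<in> L. h I = q})"
    proof (rule ccontr)
      assume "\<not> thesis"
      with that have small: "real (card {I \<in> L. h I = q}) \<le> \<rho> powr s" for q
        by (meson linorder_le_cases)
      have "L = (\<Union>q\<in>{..Q}. {I \<in> L. h I = q})" using h_le by auto
      then have "card L \<le> (\<Sum>q\<le>Q. card {I \<in> L. h I = q})"
        by (metis card_UN_le finite_atMost)
      then have "real (card L) \<le> (\<Sum>q\<le>Q. real (card {I \<in> L. h I = q}))"
        by (metis of_nat_le_iff of_nat_sum)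
      also have "\<dots> \<le> (\<Sum>q\<le>Q. \<rho> powr s)" by (intro sum_mono small)
      also have "\<dots> = \<rho> powr s * (real Q + 1)" by simp
      also have "\<dots> \<le> \<rho> powr s * (2 + ln (r / \<delta>) / ln \<kappa>)" by (intro mult_left_mono Q) simp
      also have "\<dots> < r powr t" using r_big by (simp add: \<rho>_def)
      finally show False using r(1) by (simp add: count_le_def L_def)
    qed
    define S where "S = e ` {I \<in> L. h I = q}"
    have "card S = card {I \<in> L. h I = q}"
      unfolding S_def by (intro card_image inj_on_subset[OF e(2)]) (auto simp: L_def)
    with q have cardS: "\<rho> powr s \<le> real (card S)" by simp
    have power: "card S ^ j \<le> ?N (\<rho> ^ j)" for j
    proof (rule card_power_le_count_le[OF fin pos empty mult _ _ _ _ K])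
      fix x assume "x \<in> S"
      then obtain I where I: "I \<in> lists X" "u I \<le> r" "x = e I" by (auto simp: S_def L_def)
      have "u x \<le> C * r" using C(2)[OF I(1)] C(1) I(2,3) by (smt (verit) mult_left_mono)
      then show "K * u x \<le> \<rho>" using K by (simp add: \<rho>_def)
    next
      fix x y v w assume "x \<in> S" "y \<in> S" and eq: "x @ v = y @ w"
      obtain I where I: "I \<in> lists X" "x = e I" "h I = q"
        using \<open>x \<in> S\<close> by (auto simp: S_def L_def)
      obtain J where J: "J \<in> lists X" "y = e J" "h J = q"
        using \<open>y \<in> S\<close> by (auto simp: S_def L_def)
      show "x = y" using code[of I J v w] I J eq by metis
    next
      show "finite S" unfolding S_def using finL by simp
      show "S \<subseteq> lists X" unfolding S_def L_def using e(1) by blast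
      show "0 \<le> \<rho>" using \<rho> by linarith
    qed
    \<comment> \<open>Rounding \<open>R\<close> down to a power of \<open>\<rho>\<close> loses at
      most the factor \<open>\<rho> powr s\<close>, which the gap \<open>t' < s\<close>
      absorbs.\<close>
    have "\<forall>\<^sub>F R in at_top. R powr t' * \<rho> powr s \<le> R powr s"
      using s(2) \<rho> by real_asymp
    then show ?thesis
      using eventually_ge_at_top[of \<rho>]
    proof eventually_elim
      case (elim R)
      define j where "j = nat \<lfloor>log \<rho> R\<rfloor>"
      have "log \<rho> R \<ge> 1" using elim \<rho> by simp
      then have j: "real j \<le> log \<rho> R" "log \<rho> R \<le> real j + 1" unfolding j_def by linarith+
      have R: "\<rho> ^ j \<le> R" "R \<le> \<rho> ^ j * \<rho>"
        using j elim \<rho> by (auto simp: le_log_iff log_le_iff powr_add powr_realpow)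
      have "R powr s \<le> (\<rho> ^ j * \<rho>) powr s" using R(2) elim \<rho> s by (intro powr_mono2) auto
      also have "\<dots> = (\<rho> powr s) ^ j * \<rho> powr s"
        using \<rho> by (simp add: powr_mult powr_powr powr_realpow[symmetric] mult_ac)
      finally have "R powr t' * \<rho> powr s \<le> (\<rho> powr s) ^ j * \<rho> powr s" using elim by linarith
      then have "R powr t' \<le> (\<rho> powr s) ^ j" using \<rho> by simp
      also have "\<dots> \<le> real (card S) ^ j" by (intro power_mono cardS) simp
      also have "\<dots> \<le> real (?N (\<rho> ^ j))" using power[of j] by (metis of_nat_le_iff of_nat_power)
      also have "\<dots> \<le> real (?N R)"
        using R(1) by (intro of_nat_mono count_le_mono fin) auto
      finally show ?case .
    qed
  qed
qed

section \<open>Matrix norms\<close>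

lemma norm_le_max_norm: "norm (X $ i $ j) \<le> max_norm X"
  unfolding max_norm_def by (intro Max_ge) (auto intro!: image_eqI[of _ _ "(i, j)"])

lemma max_norm_le_iff: "max_norm X \<le> b \<longleftrightarrow> (\<forall>i j. norm (X $ i $ j) \<le> b)"
  unfolding max_norm_def by (subst Max_le_iff) auto

lemma max_norm_nonneg: "max_norm X \<ge> 0"
  by (rule order_trans[OF norm_ge_zero norm_le_max_norm])

lemma max_norm_le_0_iff: "max_norm X \<le> 0 \<longleftrightarrow> X = 0"
proof
  assume "max_norm X \<le> 0"
  then have "X $ i $ j = 0" for i j by (simp add: max_norm_le_iff)
  then show "X = 0" unfolding Finite_Cartesian_Product.vec_eq_iff zero_index by blast
next
  assume "X = 0"
  then show "max_norm X \<le> 0" unfolding max_norm_le_iff by simp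
qed

lemma max_norm_mat_1: "max_norm (mat 1) \<le> 1"
  unfolding max_norm_le_iff
proof (intro allI)
  show "norm (mat 1 $ i $ j :: 'a) \<le> 1" for i j :: 'b
    by (cases "i = j") (simp_all add: Finite_Cartesian_Product.mat_def)
qed

text \<open>Each entry of the product is a sum of \<open>CARD('n)\<close> terms. This dimension
  factor is the \<open>K\<close> in the prefix code argument.\<close>

lemma max_norm_mult:
  fixes X Y :: "'k::real_normed_field^'n^'n"
  shows "max_norm (X ** Y) \<le> real CARD('n) * max_norm X * max_norm Y"
  unfolding max_norm_le_iff
proof (intro allI)
  fix i j
  have "norm ((X ** Y) $ i $ j) \<le> (\<Sum>k\<in>UNIV. norm (X $ i $ k * Y $ k $ j))"
    by (simp add: matrix_matrix_mult_def norm_sum)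
  also have "\<dots> \<le> (\<Sum>k\<in>(UNIV :: 'n set). max_norm X * max_norm Y)"
    by (intro sum_mono) (simp add: norm_mult mult_mono norm_le_max_norm max_norm_nonneg)
  finally show "norm ((X ** Y) $ i $ j) \<le> real CARD('n) * max_norm X * max_norm Y"
    by simp
qed

lemma invertible_mult_right_cancel:
  assumes "invertible M" "X ** M = Y ** M"
  shows "X = Y"
proof -
  obtain M' where M': "M ** M' = mat 1" using assms(1) unfolding invertible_def by blast
  have "X ** (M ** M') = Y ** (M ** M')" unfolding matrix_mul_assoc assms(2) ..
  then show ?thesis unfolding M' matrix_mul_rid .
qed

section \<open>Norms of the matrices of a word semigroup\<close>

lemma infinite_words:
  assumes "m \<ge> 1"
  shows "infinite (words m)"
proof
  assume "finite (words m)"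
  moreover have "range (\<lambda>k. replicate k 1) \<subseteq> words m"
    using assms by (auto simp: words_def)
  moreover have "inj (\<lambda>k. replicate k (1 :: nat))"
    by (rule injI) (metis length_replicate)
  ultimately show False using range_inj_infinite finite_subset by blast
qed

lemma num_words_eq_count_le: "num_words m F r = count_le (words m) (\<lambda>I. max_norm (F I)) r"
  by (simp add: num_words_def count_le_def max_ball_def)

lemma gasket_mult_finite_le:
  assumes "gasket_mult m A"
  shows "finite {I \<in> words m. max_norm (A I) \<le> r}"
proof -
  \<comment> \<open>The gasket condition speaks of positive radii only.\<close>
  have "finite {I \<in> words m. max_norm (A I) \<le> max 1 r}"
    using assms unfolding gasket_mult_def max_ball_def mem_Collect_eq by simp
  then show ?thesis by (rule rev_finite_subset) auto
qed

lemma max_norm_Nil_le: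
  assumes "word_hom m A"
  shows "max_norm (A []) \<le> 1"
proof -
  have "A [] = mat 1" using assms by (simp add: word_hom_def)
  then show ?thesis using max_norm_mat_1 by simp
qed

lemma max_norm_append_le:
  fixes A :: "nat list \<Rightarrow> 'k::real_normed_field^'n^'n"
  assumes "word_hom m A" "I \<in> words m" "J \<in> words m"
  shows "max_norm (A (I @ J)) \<le> real CARD('n) * max_norm (A I) * max_norm (A J)"
proof -
  have "A (I @ J) = A I ** A J" using assms by (simp add: word_hom_def)
  then show ?thesis using max_norm_mult by simp
qed

text \<open>If \<open>A I\<close> vanished, so would \<open>A (I @ J)\<close> for the infinitely
  many words \<open>J\<close>, and a ball would contain infinitely many words.\<close>

lemma max_norm_pos:
  assumes m: "m \<ge> 1" and hom: "word_hom m A" and gasket: "gasket_mult m A" and I: "I \<in> words m"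
  shows "max_norm (A I) > 0"
proof (rule ccontr)
  assume "\<not> max_norm (A I) > 0"
  then have "A I = 0" using max_norm_le_0_iff[of "A I"] by simp
  then have "A (I @ J) = 0" if "J \<in> words m" for J
    using hom I that by (simp add: word_hom_def)
  then have "(@) I ` words m \<subseteq> {K \<in> words m. max_norm (A K) \<le> 0}"
    using I by (auto simp: words_def max_norm_le_0_iff)
  then have "finite ((@) I ` words m)"
    using gasket_mult_finite_le[OF gasket] by (rule finite_subset)
  then show False
    using infinite_words[OF m] by (simp add: finite_image_iff inj_on_def)
qed

lemma tendsto_ln_num_words:
  fixes A :: "nat list \<Rightarrow> 'k::real_normed_field^'n^'n"
  assumes m: "m \<ge> 1" and hom: "word_hom m A" and gasket: "gasket_mult m A" and M: "invertible M"
    and reg: "regular_growth (count_le (words m) (\<lambda>I. max_norm (A I)))"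
  shows "((\<lambda>r. ereal (ln (real (num_words m (\<lambda>I. A I ** M) r)) / ln r)) \<longlongrightarrow> exponent m A) at_top"
proof -
  obtain M' where M': "M ** M' = mat 1" using M unfolding invertible_def by blast
  define n where "n = real CARD('n)"
  have n: "n > 0" by (simp add: n_def)
  \<comment> \<open>Passing to \<open>X ** M\<close> and back through \<open>M'\<close> makes the
    two norms comparable; adding 1 keeps the constants positive.\<close>
  define c where "c = n * (max_norm M' + 1)"
  have c: "c > 0" unfolding c_def using n max_norm_nonneg[of M'] by (intro mult_pos_pos) auto
  have lower: "1 / c * max_norm X \<le> max_norm (X ** M)" for X
  proof -
    have "X = (X ** M) ** M'" by (simp add: M' flip: matrix_mul_assoc)
    then have "max_norm X \<le> n * max_norm (X ** M) * max_norm M'"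
      unfolding n_def using max_norm_mult[of "X ** M" M'] by simp
    also have "\<dots> \<le> c * max_norm (X ** M)"
      using n max_norm_nonneg[of "X ** M"] by (simp add: c_def algebra_simps)
    finally show ?thesis using c by (simp add: field_simps)
  qed
  have upper: "max_norm (X ** M) \<le> n * (max_norm M + 1) * max_norm X" for X
  proof -
    have "max_norm (X ** M) \<le> n * max_norm X * max_norm M" unfolding n_def by (rule max_norm_mult)
    also have "\<dots> \<le> n * (max_norm M + 1) * max_norm X"
      using n max_norm_nonneg[of X] by (simp add: algebra_simps)
    finally show ?thesis .
  qed
  show ?thesis
    unfolding num_words_eq_count_le exponent_def
  proof (rule tendsto_ln_count_le[OF _ _ _ _ _ lower upper reg])
    show "0 < n * (max_norm M + 1)" using n max_norm_nonneg[of M] by (intro mult_pos_pos) auto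
  qed (use infinite_words[OF m] gasket_mult_finite_le[OF gasket] max_norm_pos[OF m hom gasket] c in auto)
qed

lemma min_norm_le:
  assumes "I \<in> words m"
  shows "min_norm m A (length I) \<le> max_norm (A I)"
  unfolding min_norm_def
proof (rule Min_le)
  show "finite ((\<lambda>I. max_norm (A I)) ` {J \<in> words m. length J = length I})"
    using finite_lists_length_eq[of "{1..m}" "length I"]
    by (intro finite_imageI) (simp add: words_def lists_eq_set)
qed (use assms in auto)

text \<open>Words of equal length already form a prefix code, so \<open>e\<close> is the identity,
  and hyperbolicity is exponential growth in the length.\<close>

lemma regular_growth_hyperbolic:
  fixes A :: "nat list \<Rightarrow> 'k::real_normed_field^'n^'n"
  assumes m: "m \<ge> 1" and hom: "word_hom m A" and gasket: "gasket_mult m A" and "hyperbolic m A"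
  shows "regular_growth (count_le (words m) (\<lambda>I. max_norm (A I)))"
proof -
  obtain \<alpha> c where \<alpha>: "\<alpha> > 1" "c > 0" "\<And>k. c * \<alpha> ^ k \<le> min_norm m A k"
    using assms(4) unfolding hyperbolic_def by blast
  have "c * \<alpha> ^ length I \<le> max_norm (A I)" if "I \<in> words m" for I
    using \<alpha>(3)[of "length I"] min_norm_le[OF that, of A] by linarith
  then show ?thesis
    unfolding words_def
    using gasket_mult_finite_le[OF gasket] max_norm_pos[OF m hom gasket] max_norm_Nil_le[OF hom] \<alpha>
      max_norm_append_le[OF hom]
    by (intro regular_growth_prefix_code[where e = id and C = 1 and h = length and \<kappa> = \<alpha> and \<delta> = c
          and K = "real CARD('n)"])
      (auto simp: words_def)
qed

section \<open>Fast semigroups\<close>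

text \<open>\<open>remdups_adj\<close> keeps one letter of each maximal run, so this counts runs; a
  nonempty word has one run more than it has turns.\<close>

abbreviation blocks :: "'b list \<Rightarrow> nat" where
  "blocks I \<equiv> length (remdups_adj I)"

lemma blocks_append_ge: "blocks xs \<le> blocks (xs @ ys)"
proof (induction xs rule: remdups_adj.induct)
  case (2 x)
  have "remdups_adj ([x] @ ys) \<noteq> []" by (metis Nil_is_append_conv not_Cons_self2 remdups_adj_Nil_iff)
  then show ?case by (cases "remdups_adj ([x] @ ys)") auto
qed auto

lemma blocks_snoc_new: "xs = [] \<or> last xs \<noteq> c \<Longrightarrow> blocks (xs @ [c]) = Suc (blocks xs)"
  by (induction xs rule: remdups_adj.induct) (auto split: if_splits)

lemma blocks_Cons_le: "blocks (x # xs) \<le> Suc (blocks xs)"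
  by (cases xs) auto

lemma blocks_le_drop: "blocks xs \<le> blocks (drop k xs) + k"
proof (induction k arbitrary: xs)
  case (Suc k)
  show ?case
  proof (cases xs)
    case (Cons y ys)
    with Suc[of ys] blocks_Cons_le[of y ys] show ?thesis by simp
  qed simp
qed simp

text \<open>Cutting just before the last letter of the first run loses no block, and the remainder
  starts with a two-letter turn word, as \<open>fast\<close> requires of its second factor.\<close>

lemma split_at_turn:
  assumes "blocks xs \<ge> 2"
  shows "\<exists>l i j ys. xs = replicate l i @ i # j # ys \<and> i \<noteq> j \<and> blocks (i # j # ys) = blocks xs"
  using assms
proof (induction xs rule: remdups_adj.induct)
  case (3 x y xs)
  show ?case
  proof (cases "x = y")
    case False
    then show ?thesis by (intro exI[of _ 0] exI[of _ x] exI[of _ y] exI[of _ xs]) auto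
  next
    case True
    with 3 obtain l i j ys where *: "x # xs = replicate l i @ i # j # ys" "i \<noteq> j"
      "blocks (i # j # ys) = blocks (x # xs)" by auto
    then have "x = i" by (cases l) auto
    with True * have "x # y # xs = replicate (Suc l) i @ i # j # ys" by simp
    moreover have "blocks (i # j # ys) = blocks (x # y # xs)" using *(3) True by simp
    ultimately show ?thesis using *(2) by blast
  qed
qed auto

text \<open>A single cut at a turn may lose the factor \<open>c\<close>. Cutting off at least
  \<open>k0\<close> letters at a time gives a prefix of norm at least \<open>2 / c\<close>, so each
  cut doubles the lower bound while using up at most \<open>k0\<close> blocks.\<close>

lemma fast_exponential_in_blocks:
  fixes A :: "nat list \<Rightarrow> 'k::real_normed_field^'n^'n"
  assumes m: "m \<ge> 1" and hom: "word_hom m A" and gasket: "gasket_mult m A" and "fast m A"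
  shows "\<exists>\<delta>>0. \<exists>\<kappa>>1. \<forall>I\<in>words m. \<delta> * \<kappa> ^ blocks I \<le> max_norm (A I)"
proof -
  obtain c where c: "c > 0" and "\<forall>I\<in>words m. \<forall>J\<in>turn_words m. \<forall>L\<in>words m.
      c * max_norm (A I) * max_norm (A (J @ L)) \<le> max_norm (A (I @ J @ L))"
    using assms(4) unfolding fast_def by (elim exE conjE)
  then have fast: "c * max_norm (A I) * max_norm (A (J @ L)) \<le> max_norm (A (I @ J @ L))"
    if "I \<in> words m" "J \<in> turn_words m" "L \<in> words m" for I J L
    using that by simp
  note pos = max_norm_pos[OF m hom gasket]
  have nil: "[] \<in> words m" by (simp add: words_def)
  \<comment> \<open>The finitely many words too small to compensate \<open>c\<close>;
    \<open>k0\<close> exceeds all their lengths. The maximum with 1 puts the empty word into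
    \<open>B\<close>, so \<open>B\<close> is nonempty.\<close>
  define B where "B = {I \<in> words m. max_norm (A I) \<le> max 1 (2 / c)}"
  have B: "finite B" unfolding B_def by (rule gasket_mult_finite_le[OF gasket])
  have "[] \<in> B" using nil max_norm_Nil_le[OF hom] by (simp add: B_def)
  define k0 where "k0 = Suc (Max (length ` B))"
  have long: "2 \<le> c * max_norm (A I)" if "I \<in> words m" "length I \<ge> k0" for I
  proof -
    have "I \<notin> B"
    proof
      assume "I \<in> B"
      then have "length I \<le> Max (length ` B)" using B by (intro Max_ge) auto
      with that(2) show False by (simp add: k0_def)
    qed
    then have "max_norm (A I) > 2 / c" using that(1) by (auto simp: B_def)
    then show ?thesis using c by (simp add: field_simps)
  qed
  \<comment> \<open>A lower bound for the norms of all words: the empty word gives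
    \<open>\<delta> \<le> 1\<close>, and words outside \<open>B\<close> have norm above 1.\<close>
  define \<delta> where "\<delta> = Min ((\<lambda>I. max_norm (A I)) ` B)"
  have \<delta>: "\<delta> > 0" "\<delta> \<le> max_norm (A I)" if "I \<in> words m" for I
  proof -
    show "\<delta> > 0" unfolding \<delta>_def using B \<open>[] \<in> B\<close> pos by (subst Min_gr_iff) (auto simp: B_def)
    have "\<delta> \<le> max_norm (A [])" unfolding \<delta>_def using B \<open>[] \<in> B\<close> by (intro Min_le) auto
    then have "\<delta> \<le> 1" using max_norm_Nil_le[OF hom] by linarith
    moreover have "\<delta> \<le> max_norm (A I)" if "I \<in> B" unfolding \<delta>_def using B that by (intro Min_le) auto
    ultimately show "\<delta> \<le> max_norm (A I)" using that by (cases "I \<in> B") (auto simp: B_def)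
  qed
  \<comment> \<open>The two extra blocks ensure that a turn remains after every cut.\<close>
  have grow: "\<delta> * 2 ^ p \<le> max_norm (A I)" if "I \<in> words m" "p * k0 + 2 \<le> blocks I" for I p
    using that
  proof (induction p arbitrary: I)
    case 0
    then show ?case using \<delta>(2) by simp
  next
    case (Suc p)
    define R where "R = drop k0 I"
    have bR: "p * k0 + 2 \<le> blocks R" using Suc.prems(2) blocks_le_drop[of I k0] by (simp add: R_def)
    then obtain l i j ys where R: "R = replicate l i @ i # j # ys" "i \<noteq> j"
        "blocks (i # j # ys) = blocks R"
      using split_at_turn[of R] by auto
    \<comment> \<open>The prefix also takes the first run of \<open>R\<close> except its last
      letter, so the rest begins with the turn \<open>[i, j]\<close>.\<close>
    define P where "P = take k0 I @ replicate l i"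
    have "I = take k0 I @ R" by (simp add: R_def)
    also have "\<dots> = P @ [i, j] @ ys" by (simp add: P_def R(1))
    finally have I: "I = P @ [i, j] @ ys" .
    have "k0 \<le> length I" using bR by (cases "k0 \<le> length I") (auto simp: R_def)
    then have len: "k0 \<le> length P" by (simp add: P_def)
    have w: "P \<in> words m" "ys \<in> words m" "i \<in> {1..m}" "j \<in> {1..m}"
      using Suc.prems(1) unfolding I words_def by auto
    have turn: "[i, j] \<in> turn_words m"
      unfolding turn_words_def using w R(2)
      by (intro CollectI exI[of _ i] exI[of _ j] exI[of _ 1]) simp
    have "i # j # ys \<in> words m" using w by (simp add: words_def)
    then have "\<delta> * 2 ^ p \<le> max_norm (A ([i, j] @ ys))"
      using Suc.IH bR R(3) by simp
    then have "2 * (\<delta> * 2 ^ p) \<le> (c * max_norm (A P)) * max_norm (A ([i, j] @ ys))"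
      using long[OF w(1) len] \<delta>(1)[OF nil] by (intro mult_mono) auto
    also have "\<dots> \<le> max_norm (A I)" unfolding I using fast[OF w(1) turn w(2)] .
    finally show ?case by simp
  qed
  have "k0 > 0" by (simp add: k0_def)
  \<comment> \<open>Chosen so that \<open>\<kappa>\<close> to the power \<open>k0\<close> is 2. As
    \<open>blocks I \<le> (p + 3) * k0\<close>, rounding costs at most the factor 8.\<close>
  define \<kappa> where "\<kappa> = 2 powr (1 / real k0)"
  have "\<kappa> > 1" using \<open>k0 > 0\<close> by (simp add: \<kappa>_def)
  have "\<delta> / 8 * \<kappa> ^ blocks I \<le> max_norm (A I)" if I: "I \<in> words m" for I
  proof -
    define p where "p = (blocks I - 2) div k0"
    have "blocks I \<le> (p + 1) * k0 + 2"
      using dividend_less_div_times[OF \<open>k0 > 0\<close>, of "blocks I - 2"] unfolding p_def add_mult_distrib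
      by linarith
    also have "\<dots> \<le> (p + 3) * k0" using \<open>k0 > 0\<close> by (simp add: algebra_simps)
    finally have le: "real (blocks I) \<le> (real p + 3) * real k0"
      by (metis of_nat_le_iff of_nat_mult of_nat_add of_nat_numeral)
    have "\<kappa> ^ blocks I = 2 powr (real (blocks I) / real k0)"
      by (simp add: \<kappa>_def powr_powr flip: powr_realpow)
    also have "\<dots> \<le> 2 powr (real p + 3)"
      using le \<open>k0 > 0\<close> by (intro powr_mono) (auto simp: field_simps)
    also have "\<dots> = 8 * 2 ^ p" by (simp add: powr_add powr_realpow)
    finally have "\<delta> / 8 * \<kappa> ^ blocks I \<le> \<delta> * 2 ^ p"
      using \<delta>(1)[OF I] by (simp add: field_simps)
    also have "\<dots> \<le> max_norm (A I)"
    proof (cases "blocks I \<ge> 2")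
      case True
      then have "p * k0 + 2 \<le> blocks I"
        using div_times_less_eq_dividend[of "blocks I - 2" k0] unfolding p_def by linarith
      then show ?thesis by (rule grow[OF I])
    next
      case False
      \<comment> \<open>Truncated subtraction gives \<open>p = 0\<close> here.\<close>
      then show ?thesis using \<delta>(2)[OF I] by (simp add: p_def)
    qed
    finally show ?thesis .
  qed
  then show ?thesis
    using \<delta>(1)[OF nil] \<open>\<kappa> > 1\<close> by (intro exI[of _ "\<delta> / 8"] exI[of _ \<kappa>] conjI) auto
qed

text \<open>Appending a letter that differs from the last one makes a set of words with equally many blocks
  a prefix code, as the last block of each code word is then a single letter.\<close>

lemma regular_growth_fast:
  fixes A :: "nat list \<Rightarrow> 'k::real_normed_field^'n^'n"
  assumes m: "m \<ge> 2" and hom: "word_hom m A" and gasket: "gasket_mult m A" and "fast m A"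
  shows "regular_growth (count_le (words m) (\<lambda>I. max_norm (A I)))"
proof -
  have m1: "m \<ge> 1" using m by simp
  obtain \<delta> \<kappa> where \<delta>: "\<delta> > 0" "\<kappa> > 1" "\<And>I. I \<in> words m \<Longrightarrow> \<delta> * \<kappa> ^ blocks I \<le> max_norm (A I)"
    using fast_exponential_in_blocks[OF m1 hom gasket assms(4)] by blast
  \<comment> \<open>A letter other than the last one, available since \<open>m \<ge> 2\<close>. For
    the empty word \<open>last\<close> is unspecified, but any letter starts a new block.\<close>
  define d :: "nat list \<Rightarrow> nat" where "d I = (if last I = 1 then 2 else 1)" for I
  define e where "e I = I @ [d I]" for I
  have d: "last I \<noteq> d I" "d I = 1 \<or> d I = 2" for I by (auto simp: d_def)
  have letters: "[1] \<in> words m" "[2] \<in> words m" using m by (auto simp: words_def)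
  have dw: "[d I] \<in> words m" for I using d(2)[of I] letters by auto
  define C where "C = real CARD('n) * max (max_norm (A [1])) (max_norm (A [2]))"
  note pos = max_norm_pos[OF m1 hom gasket]
  have C: "C > 0"
    unfolding C_def using pos[OF letters(1)] by (intro mult_pos_pos) (auto simp: less_max_iff_disj)
  have blocks_e: "blocks (e I) = Suc (blocks I)" for I
    unfolding e_def using d(1)[of I] by (intro blocks_snoc_new) simp
  \<comment> \<open>A proper prefix \<open>e I\<close> of \<open>e J\<close> would be a prefix of
    \<open>J\<close>, which has one block too few.\<close>
  have no_prefix: "us = []" if "e J = e I @ us" "blocks I = blocks J" for I J us
  proof (rule ccontr)
    assume "us \<noteq> []"
    then have "J = e I @ butlast us"
      using that(1) by (metis butlast_append butlast_snoc e_def)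
    then have "blocks (e I) \<le> blocks J" using blocks_append_ge by metis
    with that(2) blocks_e show False by simp
  qed
  show ?thesis
    unfolding words_def
  proof (rule regular_growth_prefix_code[where e = e and C = C and h = blocks and \<kappa> = \<kappa> and \<delta> = \<delta>
        and K = "real CARD('n)"], fold words_def)
    show "max_norm (A []) \<le> 1" using hom by (rule max_norm_Nil_le)
    show "e I \<in> words m" if "I \<in> words m" for I
      using that dw[of I] by (simp add: e_def words_def)
    show "inj_on e (words m)" by (rule inj_onI) (simp add: e_def)
    show "max_norm (A (e I)) \<le> C * max_norm (A I)" if "I \<in> words m" for I
    proof -
      have "max_norm (A (e I)) \<le> real CARD('n) * max_norm (A I) * max_norm (A [d I])"
        unfolding e_def using hom that dw by (rule max_norm_append_le)
      also have "\<dots> \<le> real CARD('n) * max_norm (A I) * max (max_norm (A [1])) (max_norm (A [2]))"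
        using d(2)[of I] max_norm_nonneg[of "A I"] by (intro mult_left_mono) auto
      finally show ?thesis by (simp add: C_def mult_ac)
    qed
    fix I J s t assume h: "blocks I = blocks J" and "e I @ s = e J @ t"
    then obtain us where "e I = e J @ us \<or> e I @ us = e J"
      by (auto simp: append_eq_append_conv2)
    then show "e I = e J" using no_prefix[of I J us] no_prefix[of J I us] h by fastforce
  qed (use gasket_mult_finite_le[OF gasket] pos max_norm_append_le[OF hom] C \<delta> in auto)
qed

section \<open>Powers of a single matrix\<close>

text \<open>Powers of a block diagonal matrix are taken block by block, so a block entry sits at a
  position \<open>(p, q)\<close> that does not depend on \<open>k\<close>.\<close>

lemma jordan_matrix_pow_entry:
  assumes "(l, a) \<in> set n_as" "i < l" "j < l"
  shows "\<exists>p q. p < sum_list (map fst n_as) \<and> q < sum_list (map fst n_as) \<and>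
    (\<forall>k. (jordan_matrix n_as ^\<^sub>m k) $$ (p, q) = (jordan_block l a ^\<^sub>m k) $$ (i, j))"
  using assms(1)
proof (induction n_as)
  case Nil
  then show ?case by simp
next
  case (Cons x n_as)
  obtain l' a' where x: "x = (l', a')" by (cases x)
  define R where "R k = jordan_matrix n_as ^\<^sub>m k" for k
  have dim: "dim_row (R k) = sum_list (map fst n_as)" "dim_col (R k) = sum_list (map fst n_as)" for k
    using pow_carrier_mat[OF jordan_matrix_carrier, of n_as k] by (auto simp: R_def)
  have eq: "jordan_matrix (x # n_as) ^\<^sub>m k =
      four_block_mat (jordan_block l' a' ^\<^sub>m k) (0\<^sub>m l' (sum_list (map fst n_as)))
        (0\<^sub>m (sum_list (map fst n_as)) l') (R k)" for k
  proof -
    have "jordan_matrix (x # n_as) ^\<^sub>m k = diag_block_mat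
        ((jordan_block l' a' ^\<^sub>m k) # map (\<lambda>(n, a). jordan_block n a ^\<^sub>m k) n_as)"
      by (simp add: jordan_matrix_pow x)
    also have "\<dots> = (let B = R k in four_block_mat (jordan_block l' a' ^\<^sub>m k)
        (0\<^sub>m (dim_row (jordan_block l' a' ^\<^sub>m k)) (dim_col B))
        (0\<^sub>m (dim_row B) (dim_col (jordan_block l' a' ^\<^sub>m k))) B)"
      unfolding diag_block_mat.simps R_def jordan_matrix_pow ..
    finally show ?thesis by (simp only: Let_def dim jordan_block_pow_dim)
  qed
  have sum: "sum_list (map fst (x # n_as)) = l' + sum_list (map fst n_as)" by (simp add: x)
  show ?case
  proof (cases "(l, a) = x")
    case True
    then have la: "l' = l" "a' = a" by (auto simp: x)
    show ?thesis
      unfolding eq sum unfolding la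
      using assms(2,3) dim by (intro exI[of _ i] exI[of _ j]) simp
  next
    case False
    then have "(l, a) \<in> set n_as" using Cons.prems by simp
    from Cons.IH[OF this] obtain p q where pq: "p < sum_list (map fst n_as)" "q < sum_list (map fst n_as)"
      and k: "\<And>k. R k $$ (p, q) = (jordan_block l a ^\<^sub>m k) $$ (i, j)"
      unfolding R_def by blast
    show ?thesis
      unfolding eq sum
      using pq dim by (intro exI[of _ "l' + p"] exI[of _ "l' + q"]) (simp add: k)
  qed
qed

text \<open>The base change matrices are the same for all powers, so entries of the Jordan form's
  powers are bounded by a constant times any entry bound for \<open>B ^\<^sub>m k\<close>.\<close>

lemma jordan_nf_pow_norm_bound_entry:
  fixes B :: "complex mat"
  assumes "B \<in> carrier_mat n n" "jordan_nf B n_as" "(l, a) \<in> set n_as" "i < l" "j < l"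
  shows "\<exists>c>0. \<forall>k b. norm_bound (B ^\<^sub>m k) b \<longrightarrow> c * norm ((jordan_block l a ^\<^sub>m k) $$ (i, j)) \<le> b"
proof -
  let ?J = "jordan_matrix n_as"
  obtain P Q where "similar_mat_wit B ?J P Q"
    using assms(2) unfolding jordan_nf_def similar_mat_def by auto
  then have wit: "similar_mat_wit (?J ^\<^sub>m k) (B ^\<^sub>m k) Q P" for k
    by (rule similar_mat_wit_pow[OF similar_mat_wit_sym])
  have car: "B ^\<^sub>m k \<in> carrier_mat n n" for k
    using assms(1) by (rule pow_carrier_mat)
  have sub: "{?J ^\<^sub>m k, B ^\<^sub>m k, Q, P} \<subseteq> carrier_mat (dim_row (?J ^\<^sub>m k)) (dim_row (?J ^\<^sub>m k))" 
    and J: "?J ^\<^sub>m k = Q * (B ^\<^sub>m k) * P" for k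
    using wit[of k] unfolding similar_mat_wit_def Let_def by blast+
  have dimJ: "dim_row (?J ^\<^sub>m k) = n" for k
  proof -
    have "B ^\<^sub>m k \<in> carrier_mat (dim_row (?J ^\<^sub>m k)) (dim_row (?J ^\<^sub>m k))" using sub[of k] by blast
    from carrier_matD(1)[OF this] carrier_matD(1)[OF car[of k]] show ?thesis by (rule trans[OF sym])
  qed
  have QP: "Q \<in> carrier_mat n n" "P \<in> carrier_mat n n" and J_carrier: "?J ^\<^sub>m k \<in> carrier_mat n n" for k
    using sub[of k] dimJ[of k] by auto
  have sum: "sum_list (map fst n_as) = n" using dimJ[of 1] by simp
  \<comment> \<open>The bounds are then raised to at least 1, so that the constant \<open>C\<close>
    is positive.\<close>
  obtain bQ bP where "norm_bound Q bQ" "norm_bound P bP"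
    using norm_bound_max by blast
  then have b: "norm_bound Q (max 1 bQ)" "norm_bound P (max 1 bP)"
    unfolding norm_bound_def by (auto simp: le_max_iff_disj)
  obtain p q where pq: "p < n" "q < n" "\<And>k. (?J ^\<^sub>m k) $$ (p, q) = (jordan_block l a ^\<^sub>m k) $$ (i, j)"
    using jordan_matrix_pow_entry[OF assms(3-5)] unfolding sum by blast
  have n: "n > 0" using pq(1) by simp
  define C where "C = max 1 bQ * real n * max 1 bP * real n"
  have C: "C > 0" unfolding C_def using n by (intro mult_pos_pos) auto
  have "norm ((jordan_block l a ^\<^sub>m k) $$ (i, j)) \<le> C * b" if "norm_bound (B ^\<^sub>m k) b" for k b
  proof -
    have "norm_bound (?J ^\<^sub>m k) (max 1 bQ * b * real n * max 1 bP * real n)"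
      unfolding J using norm_bound_mult[OF mult_carrier_mat[OF QP(1) car] QP(2) 
        norm_bound_mult[OF QP(1) car b(1) that] b(2)] .
    then have "norm ((?J ^\<^sub>m k) $$ (p, q)) \<le> max 1 bQ * b * real n * max 1 bP * real n"
      using pq(1,2) unfolding norm_bound_def carrier_matD[OF J_carrier] by blast
    then show ?thesis 
      unfolding pq(3) by (simp add: C_def mult_ac)
  qed
  then show ?thesis
    using C by (intro exI[of _ "1 / C"]) (auto simp: field_simps)
qed

text \<open>An eigenvalue of modulus above 1 gives exponential growth. Otherwise the largest Jordan
  block with eigenvalue of modulus 1, of size \<open>N\<close>, decides: its powers have a corner
  entry of modulus \<open>k choose (N - 1)\<close>, which matches the general upper bound of order
  \<open>k ^ (N - 1)\<close>.\<close>

lemma norm_bound_pow_cases: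
  fixes B :: "complex mat"
  assumes B: "B \<in> carrier_mat n n"
  obtains (exponential) c \<alpha> where "c > 0" "\<alpha> > 1"
      "\<And>k b. norm_bound (B ^\<^sub>m k) b \<Longrightarrow> c * \<alpha> ^ k \<le> b"
    | (bounded) C where "\<And>k. norm_bound (B ^\<^sub>m k) C"
    | (polynomial) c C d where "c > 0" "d > 0"
      "\<And>k b. norm_bound (B ^\<^sub>m k) b \<Longrightarrow> c * real (k choose d) \<le> b"
      "\<And>k. norm_bound (B ^\<^sub>m k) (C + C * real k ^ d)"
proof -
  obtain n_as where nf: "jordan_nf B n_as"
    using char_poly_factorized[OF B] jordan_nf_exists[OF B] by blast
  show ?thesis
  proof (cases "\<exists>(l, a) \<in> set n_as. norm a > 1")
    case True
    then obtain l a where la: "(l, a) \<in> set n_as" "norm a > 1" by auto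
    have "l > 0" using nf la(1) unfolding jordan_nf_def by (cases l) force+
    then obtain c where "c > 0" "\<forall>k b. norm_bound (B ^\<^sub>m k) b \<longrightarrow> 
        c * norm ((jordan_block l a ^\<^sub>m k) $$ (0, 0)) \<le> b"
      using jordan_nf_pow_norm_bound_entry[OF B nf la(1)] by blast
    with \<open>l > 0\<close> la(2) show ?thesis
      by (intro exponential[of c "norm a"]) (auto simp: jordan_block_pow norm_power)
  next
    case False
    then have le: "norm a \<le> 1" if "(l, a) \<in> set n_as" for l a using that by force
    \<comment> \<open>Inserting 0 keeps the maximum meaningful when no eigenvalue has modulus
      1.\<close>
    define S where "S = insert 0 (fst ` {x \<in> set n_as. norm (snd x) = 1})"
    define N where "N = Max S"
    have fin: "finite S" unfolding S_def by auto
    have N: "l \<le> N" if "(l, a) \<in> set n_as" "norm a = 1" for l a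
      unfolding N_def using that by (intro Max_ge fin) (force simp: S_def)
    obtain c1 c2 where c: "\<And>k. norm_bound (B ^\<^sub>m k) (c1 + c2 * real k ^ (N - 1))"
      using jordan_nf_matrix_poly_bound[OF B _ _ nf, of N] le N by blast
    show ?thesis
    proof (cases "N \<le> 1")
      case True
      then show ?thesis using c by (intro bounded[of "c1 + c2"]) auto
    next
      case False
      have "N \<in> S" unfolding N_def by (rule Max_in[OF fin]) (simp add: S_def)
      with False obtain a where a: "(N, a) \<in> set n_as" "norm a = 1"
        unfolding S_def by auto
      obtain c0 where c0: "c0 > 0" "\<And>k b. norm_bound (B ^\<^sub>m k) b \<Longrightarrow>
          c0 * norm ((jordan_block N a ^\<^sub>m k) $$ (0, N - 1)) \<le> b"
        using jordan_nf_pow_norm_bound_entry[OF B nf a(1), of 0 "N - 1"] False by auto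
      have "norm ((jordan_block N a ^\<^sub>m k) $$ (0, N - 1)) = real (k choose (N - 1))" for k
        using False a(2) by (simp add: jordan_block_pow norm_mult norm_power)
      moreover have "norm_bound (B ^\<^sub>m k) (max c1 c2 + max c1 c2 * real k ^ (N - 1))" for k
      proof -
        have "c1 + c2 * real k ^ (N - 1) \<le> max c1 c2 + max c1 c2 * real k ^ (N - 1)"
          by (intro add_mono mult_right_mono) auto
        then show ?thesis using c[of k] unfolding norm_bound_def by force
      qed
      ultimately show ?thesis
        using False c0 by (intro polynomial[of c0 "N - 1" "max c1 c2"]) auto
    qed
  qed
qed

section \<open>Counting for one-letter semigroups\<close>

lemma count_le_reindex:
  assumes "inj f"
  shows "count_le (range f) u r = count_le UNIV (\<lambda>k. u (f k)) r"
proof -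
  have "{x \<in> range f. u x \<le> r} = f ` {k \<in> UNIV. u (f k) \<le> r}" by auto
  then show ?thesis
    unfolding count_le_def using assms by (simp add: card_image inj_on_def)
qed

text \<open>Here \<open>u k\<close> has the order of \<open>k ^ d\<close>, so the count has the
  order of \<open>r powr (1 / d)\<close>. A power that the count exceeds for arbitrarily large
  \<open>r\<close> thus has exponent at most \<open>1 / d\<close>, and every smaller exponent works
  for all large \<open>r\<close>.\<close>

lemma regular_growth_polynomial:
  fixes u :: "nat \<Rightarrow> real"
  assumes c: "c > 0" and d: "d > 0" and lower: "\<And>k. c * real (k choose d) \<le> u k"
    and upper: "\<And>k. u k \<le> C + C * real k ^ d"
  shows "regular_growth (count_le UNIV u)"
proof -
  define q where "q = 1 / real d"
  have q: "q > 0" using d by (simp add: q_def)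
  have root: "x \<le> y powr q" if "x \<ge> 0" "x ^ d \<le> y" for x y
  proof -
    have "x = (x powr real d) powr q" using that d by (simp add: powr_powr q_def)
    also have "\<dots> \<le> y powr q" 
      using that d q by (intro powr_mono2) (auto simp: powr_realpow')
    finally show ?thesis .
  qed
  \<comment> \<open>From \<open>(k / d) ^ d \<le> k choose d\<close> for \<open>k \<ge> d\<close>;
    smaller \<open>k\<close>, where the binomial coefficient vanishes, are covered by the summand
    \<open>d\<close> in \<open>small\<close>.\<close>
  define U where "U r = d * (r / c) powr q" for r
  have small: "real k \<le> real d + U r" if "u k \<le> r" for k r
  proof (cases "k \<ge> d")
    case True
    have "c * (real k / real d) ^ d \<le> c * real (k choose d)"
      using binomial_ge_n_over_k_pow_k[OF True, where 'a = real] c by (intro mult_left_mono) auto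
    also have "\<dots> \<le> r" using lower[of k] that by linarith
    finally have "(real k / real d) ^ d \<le> r / c" using c by (simp add: field_simps)
    then have "real k / real d \<le> (r / c) powr q" by (intro root) auto
    then show ?thesis using d by (simp add: U_def field_simps)
  next
    case False
    have "U r \<ge> 0" by (simp add: U_def)
    with False show ?thesis by linarith
  qed
  have subset: "{k \<in> UNIV. u k \<le> r} \<subseteq> {..nat \<lfloor>real d + U r\<rfloor>}" for r
    using le_nat_floor[OF small] by blast
  have fin: "finite {k \<in> UNIV. u k \<le> r}" for r
    by (rule finite_subset[OF subset]) simp
  have N_upper: "real (count_le UNIV u r) \<le> real d + U r + 1" for r
  proof -
    have "U r \<ge> 0" by (simp add: U_def)
    moreover have "count_le UNIV u r \<le> Suc (nat \<lfloor>real d + U r\<rfloor>)"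
      unfolding count_le_def using card_mono[OF _ subset, of r] by simp
    ultimately show ?thesis by linarith
  qed
  define D where "D = max 1 C"
  \<comment> \<open>For \<open>r > D\<close> this solves \<open>D + D * V r ^ d = r\<close>;
    rounding down costs the 1 in \<open>N_lower\<close>.\<close>
  define V where "V r = ((r - D) / D) powr q" for r
  have D: "D > 0" "\<And>k. u k \<le> D + D * real k ^ d"
  proof -
    show "D > 0" by (simp add: D_def)
    fix k
    have "C + C * real k ^ d \<le> D + D * real k ^ d"
      unfolding D_def by (intro add_mono mult_right_mono) auto
    then show "u k \<le> D + D * real k ^ d" using upper[of k] by linarith
  qed
  have N_lower: "V r - 1 \<le> real (count_le UNIV u r)" if "r > D" for r
  proof -
    have "{..<nat \<lfloor>V r\<rfloor>} \<subseteq> {k \<in> UNIV. u k \<le> r}"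
    proof
      fix k assume "k \<in> {..<nat \<lfloor>V r\<rfloor>}"
      then have "real k \<le> V r" by (simp add: V_def) linarith
      then have "real k ^ d \<le> V r ^ d" by (intro power_mono) auto
      also have "\<dots> = (r - D) / D"
        using d that D(1) by (simp add: V_def q_def powr_powr flip: powr_realpow)
      finally have "D + D * real k ^ d \<le> r" using D(1) by (simp add: field_simps)
      then show "k \<in> {k \<in> UNIV. u k \<le> r}" using D(2)[of k] by simp
    qed
    from card_mono[OF fin this] have "nat \<lfloor>V r\<rfloor> \<le> count_le UNIV u r" by (simp add: count_le_def)
    then show ?thesis by linarith
  qed
  show ?thesis
    unfolding regular_growth_def
  proof (intro allI impI)
    fix t t' :: real
    assume t: "t' < t" and freq: "\<exists>\<^sub>F r in at_top. r powr t \<le> real (count_le UNIV u r)"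
    have "t \<le> q"
    proof (rule ccontr)
      assume "\<not> t \<le> q"
      then have tq: "q < t" by simp
      have "\<forall>\<^sub>F r in at_top. real d + real d * (r / c) powr q + 1 < r powr t"
        using tq c d q by real_asymp
      then have "\<forall>\<^sub>F r in at_top. \<not> r powr t \<le> real (count_le UNIV u r)"
        by eventually_elim (use N_upper in \<open>simp add: U_def not_le, smt (verit)\<close>)
      with freq show False by (simp add: frequently_def)
    qed
    with t have t'q: "t' < q" by simp
    have "\<forall>\<^sub>F r in at_top. r powr t' \<le> ((r - D) / D) powr q - 1"
      using t'q q D(1) by real_asymp
    then show "\<forall>\<^sub>F r in at_top. r powr t' \<le> real (count_le UNIV u r)"
      using eventually_gt_at_top[of D]
    proof eventually_elim
      case (elim r)
      then show ?case using N_lower[of r] by (simp add: V_def)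
    qed
  qed
qed

text \<open>A norm-preserving field embedding \<open>f\<close> and an enumeration \<open>g\<close>
  of the index type carry the powers \<open>F k\<close> to complex matrices to which Jordan normal
  form applies; entry bounds are unchanged.\<close>

lemma ex_complex_matrix_powers:
  fixes X :: "'k::real_normed_field^'n^'n" and f :: "'k \<Rightarrow> complex"
  assumes f: "f 0 = 0" "f 1 = 1" "\<And>x y. f (x + y) = f x + f y" "\<And>x y. f (x * y) = f x * f y"
    "\<And>x. norm (f x) = norm x"
    and F: "F 0 = mat 1" "\<And>k. F (Suc k) = F k ** X"
  shows "\<exists>B :: complex mat. B \<in> carrier_mat CARD('n) CARD('n) \<and>
    (\<forall>k b. norm_bound (B ^\<^sub>m k) b \<longleftrightarrow> max_norm (F k) \<le> b)"
proof -
  let ?n = "CARD('n)"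
  obtain g where g: "bij_betw g {0..<?n} (UNIV :: 'n set)"
    using ex_bij_betw_nat_finite[of "UNIV :: 'n set"] by auto
  define T where "T Y = Matrix.mat ?n ?n (\<lambda>(i, j). f (Y $ g i $ g j))" for Y :: "'k^'n^'n"
  have T_carrier: "T Y \<in> carrier_mat ?n ?n" for Y by (simp add: T_def)
  have f_sum: "f (sum h S) = (\<Sum>x\<in>S. f (h x))" if "finite S" for h and S :: "'n set"
    using that by (induction S rule: finite_induct) (auto simp: f)
  have T_mult: "T (Y ** Z) = T Y * T Z" for Y Z
  proof (rule eq_matI)
    fix i j assume "i < dim_row (T Y * T Z)" "j < dim_col (T Y * T Z)"
    then have ij: "i < ?n" "j < ?n" by (auto simp: T_def)
    have "(T (Y ** Z)) $$ (i, j) = (\<Sum>k\<in>UNIV. f (Y $ g i $ k) * f (Z $ k $ g j))"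
      using ij by (simp add: T_def matrix_matrix_mult_def f_sum f)
    also have "\<dots> = (\<Sum>k = 0..<?n. f (Y $ g i $ g k) * f (Z $ g k $ g j))"
      by (rule sum.reindex_bij_betw[OF g, symmetric])
    also have "\<dots> = (T Y * T Z) $$ (i, j)"
      using ij by (simp add: T_def scalar_prod_def)
    finally show "(T (Y ** Z)) $$ (i, j) = (T Y * T Z) $$ (i, j)" .
  qed (auto simp: T_def)
  have T_one: "T (mat 1) = 1\<^sub>m ?n"
  proof (rule eq_matI)
    fix i j assume "i < dim_row (1\<^sub>m ?n :: complex mat)" "j < dim_col (1\<^sub>m ?n :: complex mat)"
    then have ij: "i < ?n" "j < ?n" by auto
    then have "g i = g j \<longleftrightarrow> i = j" using bij_betw_imp_inj_on[OF g] by (auto simp: inj_on_def)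
    then show "T (mat 1) $$ (i, j) = 1\<^sub>m ?n $$ (i, j)"
      using ij by (simp add: T_def Finite_Cartesian_Product.mat_def f)
  qed (auto simp: T_def)
  have T_pow: "T X ^\<^sub>m k = T (F k)" for k
    by (induction k) (simp_all add: F T_one T_mult carrier_matD[OF T_carrier])
  have T_bound: "norm_bound (T Y) b \<longleftrightarrow> max_norm Y \<le> b" for Y b
  proof -
    have "norm_bound (T Y) b \<longleftrightarrow> (\<forall>i\<in>{0..<?n}. \<forall>j\<in>{0..<?n}. norm (Y $ g i $ g j) \<le> b)"
      by (auto simp: norm_bound_def T_def f)
    also have "\<dots> \<longleftrightarrow> (\<forall>i\<in>g ` {0..<?n}. \<forall>j\<in>g ` {0..<?n}. norm (Y $ i $ j) \<le> b)"
      by blast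
    also have "\<dots> \<longleftrightarrow> max_norm Y \<le> b"
      by (simp add: bij_betw_imp_surj_on[OF g] max_norm_le_iff)
    finally show ?thesis .
  qed
  show ?thesis
    using T_carrier[of X] by (intro exI[of _ "T X"]) (simp add: T_pow T_bound)
qed

lemma words_1: "words 1 = range (\<lambda>k. replicate k 1)"
proof (intro equalityI subsetI)
  fix I assume "I \<in> words 1"
  then have "\<forall>i\<in>set I. i = 1" by (auto simp: words_def)
  then have "I = replicate (length I) 1" by (metis replicate_length_same)
  then show "I \<in> range (\<lambda>k. replicate k 1)" by blast
qed (auto simp: words_def)

lemma min_norm_1: "min_norm 1 A k = max_norm (A (replicate k 1))"
proof -
  have "{I \<in> words 1. length I = k} = {replicate k 1}" unfolding words_1 by auto
  then show ?thesis by (simp add: min_norm_def)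
qed

text \<open>Of the three growth types of the powers of \<open>A [1]\<close>, parabolicity excludes
  the exponential one and the gasket condition the bounded one, which leaves polynomial
  growth.\<close>

lemma regular_growth_parabolic_1:
  fixes A :: "nat list \<Rightarrow> 'k::real_normed_field^'n^'n" and f :: "'k \<Rightarrow> complex"
  assumes f: "f 0 = 0" "f 1 = 1" "\<And>x y. f (x + y) = f x + f y" "\<And>x y. f (x * y) = f x * f y"
    "\<And>x. norm (f x) = norm x"
    and hom: "word_hom 1 A" and gasket: "gasket_mult 1 A" and parabolic: "parabolic 1 A"
  shows "regular_growth (count_le (words 1) (\<lambda>I. max_norm (A I)))"
proof -
  define F where "F k = A (replicate k 1)" for k
  have F0: "F 0 = mat 1" using hom by (simp add: F_def word_hom_def)
  have FS: "\<And>k. F (Suc k) = F k ** A [1]"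
  proof -
    fix k
    have "replicate (Suc k) (1 :: nat) = replicate k 1 @ [1]" by (simp add: replicate_append_same)
    moreover have "replicate k 1 \<in> words 1" "[1] \<in> words 1" by (auto simp: words_def)
    ultimately show "F (Suc k) = F k ** A [1]" using hom unfolding F_def word_hom_def by metis
  qed
  from ex_complex_matrix_powers[of f, OF f F0 FS] obtain B :: "complex mat"
    where B: "B \<in> carrier_mat CARD('n) CARD('n)"
    and "\<forall>k b. norm_bound (B ^\<^sub>m k) b \<longleftrightarrow> max_norm (F k) \<le> b"
    by (elim exE conjE)
  then have bound: "norm_bound (B ^\<^sub>m k) b \<longleftrightarrow> max_norm (F k) \<le> b" for k b
    by simp
  have inj: "inj (\<lambda>k. replicate k (1 :: nat))" by (rule injI) (metis length_replicate)
  show ?thesis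
    using B
  proof (cases rule: norm_bound_pow_cases)
    case (exponential c \<alpha>)
    have "min_norm 1 A \<in> o(\<lambda>k. \<alpha> ^ k)" using parabolic exponential(2) by (simp add: parabolic_def)
    from landau_o.smallD[OF this, of "c / 2"] exponential(1)
    have "\<forall>\<^sub>F k in sequentially. norm (min_norm 1 A k) \<le> c / 2 * norm (\<alpha> ^ k)" by simp
    then obtain k where "\<bar>min_norm 1 A k\<bar> \<le> c / 2 * \<bar>\<alpha> ^ k\<bar>"
      by (auto dest: eventually_happens)
    moreover have "\<alpha> ^ k > 0" using exponential(2) by simp
    moreover have "c * \<alpha> ^ k \<le> min_norm 1 A k"
      using exponential(3)[of k] unfolding bound min_norm_1 F_def by simp
    moreover have "c * \<alpha> ^ k > 0" using exponential(1) \<open>\<alpha> ^ k > 0\<close> by simp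
    ultimately have False by (simp add: abs_if split: if_splits)
    then show ?thesis ..
  next
    case (bounded C)
    then have "words 1 \<subseteq> {I \<in> words 1. max_norm (A I) \<le> C}"
      unfolding words_1 bound F_def by auto
    then have False
      using gasket_mult_finite_le[OF gasket, of C] infinite_words[of 1] finite_subset by auto
    then show ?thesis ..
  next
    case (polynomial c C d)
    have "regular_growth (count_le UNIV (\<lambda>k. max_norm (F k)))"
      using polynomial bound by (intro regular_growth_polynomial[of c d _ C]) auto
    moreover have "count_le (words 1) (\<lambda>I. max_norm (A I)) = count_le UNIV (\<lambda>k. max_norm (F k))"
      unfolding words_1 F_def by (rule ext) (rule count_le_reindex[OF inj])
    ultimately show ?thesis by simp
  qed
qed

section \<open>Both ways of counting, over both fields\<close>

lemma tendsto_ln_num_words_and_matrices: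
  fixes A :: "nat list \<Rightarrow> 'k::real_normed_field^'n^'n" and f :: "'k \<Rightarrow> complex"
  assumes f: "f 0 = 0" "f 1 = 1" "\<And>x y. f (x + y) = f x + f y" "\<And>x y. f (x * y) = f x * f y"
    "\<And>x. norm (f x) = norm x"
    and m: "m \<ge> 1" and hom: "word_hom m A" and type: "hyperbolic m A \<or> (fast m A \<and> parabolic m A)"
    and M: "invertible M"
  shows "(gasket m A \<and> inj_on A (words m) \<longrightarrow>
      ((\<lambda>r. ereal (ln (real (num_matrices m (\<lambda>I. A I ** M) r)) / ln r)) \<longlongrightarrow> exponent m A) at_top) \<and>
    (gasket_mult m A \<longrightarrow>
      ((\<lambda>r. ereal (ln (real (num_words m (\<lambda>I. A I ** M) r)) / ln r)) \<longlongrightarrow> exponent m A) at_top)"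
proof (rule conjI; intro impI)
  have lim: "((\<lambda>r. ereal (ln (real (num_words m (\<lambda>I. A I ** M) r)) / ln r)) \<longlongrightarrow> exponent m A) at_top"
    if gasket: "gasket_mult m A"
  proof (rule tendsto_ln_num_words[OF m hom gasket M])
    consider "hyperbolic m A" | "fast m A" "m \<ge> 2" | "parabolic m A" "m = 1"
      using type m by linarith
    then show "regular_growth (count_le (words m) (\<lambda>I. max_norm (A I)))"
      by cases (use regular_growth_hyperbolic[OF m hom gasket] regular_growth_fast[OF _ hom gasket]
        regular_growth_parabolic_1[of f A, OF f] hom gasket in blast)+
  qed
  then show "gasket_mult m A \<Longrightarrow>
    ((\<lambda>r. ereal (ln (real (num_words m (\<lambda>I. A I ** M) r)) / ln r)) \<longlongrightarrow> exponent m A) at_top" .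
  assume inj: "gasket m A \<and> inj_on A (words m)"
  \<comment> \<open>Right multiplication by \<open>M\<close> is injective, so counting distinct
    matrices is the same as counting words.\<close>
  then have "inj_on (\<lambda>I. A I ** M) (words m)"
    using invertible_mult_right_cancel[OF M] by (auto simp: inj_on_def)
  note num_words_eq_num_matrices[OF this]
  moreover have "gasket_mult m A" using inj gasket_mult_iff_gasket by blast
  ultimately show "((\<lambda>r. ereal (ln (real (num_matrices m (\<lambda>I. A I ** M) r)) / ln r)) \<longlongrightarrow> exponent m A) at_top"
    using lim by simp
qed

theorem theorem3:
  fixes m :: nat
  assumes "m \<ge> 1"
  shows
    "(\<forall>(A :: nat list \<Rightarrow> real^'n^'n) (M :: real^'n^'n).
        word_hom m A \<and> (hyperbolic m A \<or> (fast m A \<and> parabolic m A)) \<and> invertible M \<longrightarrow>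
          (gasket m A \<and> inj_on A (words m) \<longrightarrow>
            ((\<lambda>r. ereal (ln (real (num_matrices m (\<lambda>I. A I ** M) r)) / ln r)) \<longlongrightarrow> exponent m A) at_top) \<and>
          (gasket_mult m A \<longrightarrow>
            ((\<lambda>r. ereal (ln (real (num_words m (\<lambda>I. A I ** M) r)) / ln r)) \<longlongrightarrow> exponent m A) at_top))
   \<and> (\<forall>(A :: nat list \<Rightarrow> complex^'n^'n) (M :: complex^'n^'n).
        word_hom m A \<and> (hyperbolic m A \<or> (fast m A \<and> parabolic m A)) \<and> invertible M \<longrightarrow>
          (gasket m A \<and> inj_on A (words m) \<longrightarrow>
            ((\<lambda>r. ereal (ln (real (num_matrices m (\<lambda>I. A I ** M) r)) / ln r)) \<longlongrightarrow> exponent m A) at_top) \<and>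
          (gasket_mult m A \<longrightarrow>
            ((\<lambda>r. ereal (ln (real (num_words m (\<lambda>I. A I ** M) r)) / ln r)) \<longlongrightarrow> exponent m A) at_top))"
  \<comment> \<open>The embedding into the complex numbers is \<open>of_real\<close> for real
    matrices and \<open>id\<close> for complex ones.\<close>
  by (intro conjI[OF allI allI] allI impI; elim conjE;
      rule tendsto_ln_num_words_and_matrices[where f = of_real]
        tendsto_ln_num_words_and_matrices[where f = id]; simp add: assms[unfolded One_nat_def] norm_mult)

end
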